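(* Let $s,t\ge1$ be coprime integers, let $k=\frac12(s+1)(t-1)$, and let $\lambda$ be an $s$-core with $t$-core $\lambda^t$. For $j\in\mathbb{Z}/t\mathbb{Z}$ define $$z_{t,j}(\lambda^t)=\frac1t\bigl(a_{t,sj+k}(\lambda^t)-[a_{t,s(j+1)+k}(\lambda^t)-s]\bigr).$$ Then $$z_{t,j}(\lambda^t)=\bigl|[\mathcal{S}_s(\lambda)-s]\cap(sj+k+t\mathbb{Z})\bigr|\qquad\text{for all } j\in\mathbb{Z}/t\mathbb{Z},$$ and $$|\mathrm{Stab}_{G_{s,t}}(\lambda)|=\prod_{j\in\mathbb{Z}/t\mathbb{Z}}\left(\frac{a_{t,j}(\lambda^t)-[a_{t,j+s}(\lambda^t)-s]}{t}\right)!=\prod_{j\in\mathbb{Z}/t\mathbb{Z}}z_{t,j}(\lambda^t)!.$$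
   Context: A partition is an infinite weakly decreasing sequence $\lambda=(\lambda_1,\lambda_2,\ldots)$ of nonnegative integers with finite sum. Its Young diagram is $[\lambda]=\{(r,c)\in\mathbb{Z}_{>0}^2 : c\le\lambda_r\}$, its conjugate $\overline{\lambda}$ is given by $\overline{\lambda}_r=\#\{c\in\mathbb{Z}_{>0}: r\le\lambda_c\}$. The rim hook of $(r,c)\in[\lambda]$ is $\{(i,j)\in[\lambda]: i\ge r,\ j\ge c,\ (i+1,j+1)\notin[\lambda]\}$, of length $1+(\lambda_r-r)+(\overline{\lambda}_c-c)$; removing it leaves the Young diagram of a smaller partition. A partition is an $s$-core if it has no rim hook of length $s$; $\mathcal{C}_s$ is the set of $s$-cores. For any partition $\lambda$ and $t\ge1$, repeatedly removing rim hooks of length $t$ until none remains yields a $t$-core, independent of the choices made, denoted $\lambda^t$; if $\lambda\in\mathcal{C}_s$ then $\lambda^t\in\mathcal{C}_s\cap\mathcal{C}_t$. The beta-set of $\lambda$ is $B^\lambda=\{\lambda_i-i: i\ge1\}\subset\mathbb{Z}$. For an $s$-core $\lambda$ and $i\in\mathbb{Z}$ (only $i$ mod $s$ matters) put $a_{s,i}(\lambda)=s+\max[B^\lambda\cap(i+s\mathbb{Z})]$, and $\mathcal{S}_s(\lambda)=\{a_{s,i}(\lambda)\}_{i\in\mathbb{Z}/s\mathbb{Z}}=(B^\lambda+s)\setminus B^\lambda$ (the $s$-set). The same notation is used with $t$ in place of $s$ for $t$-cores. The map $\lambda\mapsto\mathcal{S}_s(\lambda)$ is a bijection from $\mathcal{C}_s$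 to the collection of all sets of $s$ integers pairwise incongruent modulo $s$ with sum $\binom{s}{2}$. $G_{s,t}$ is the group (under composition) of permutations $f:\mathbb{Z}\to\mathbb{Z}$ such that $f(m+s)=f(m)+s$ for all $m$; $\sum_{i=0}^{s-1}f(i)=\binom{s}{2}$; and $f(m)\equiv m\pmod t$ for all $m$. It acts on $\mathcal{C}_s$ by letting $f\lambda$ be the $s$-core with $\mathcal{S}_s(f\lambda)=f(\mathcal{S}_s(\lambda))$. *)

theory Defs
  imports Complex_Main "HOL-Algebra.Group_Action" "HOL-Number_Theory.Cong"
begin

(* A partition is a sequence indexed by the positive integers.  The value at the unused index 0
   is fixed to be 0, so that equal partitions are equal as functions.  For weakly decreasing
   sequences of natural numbers, finite support is the same as finite sum. *)
definition is_partition :: "(nat \<Rightarrow> nat) \<Rightarrow> bool" where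
  "is_partition p \<longleftrightarrow> p 0 = 0 \<and> (\<forall>i\<ge>1. p (Suc i) \<le> p i) \<and> finite {i. p i \<noteq> 0}"

definition young_diagram :: "(nat \<Rightarrow> nat) \<Rightarrow> (nat \<times> nat) set" where
  "young_diagram p = {(r, c). r \<ge> 1 \<and> c \<ge> 1 \<and> c \<le> p r}"

definition conjugate_partition :: "(nat \<Rightarrow> nat) \<Rightarrow> nat \<Rightarrow> nat" where
  "conjugate_partition p r = card {c. c \<ge> 1 \<and> r \<le> p c}"

definition rim_hook :: "(nat \<Rightarrow> nat) \<Rightarrow> nat \<Rightarrow> nat \<Rightarrow> (nat \<times> nat) set" where
  "rim_hook p r c =
     {(i, j). (i, j) \<in> young_diagram p \<and> i \<ge> r \<and> j \<ge> c \<and> (i + 1, j + 1) \<notin> young_diagram p}"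

definition hook_length :: "(nat \<Rightarrow> nat) \<Rightarrow> nat \<Rightarrow> nat \<Rightarrow> int" where
  "hook_length p r c = 1 + (int (p r) - int r) + (int (conjugate_partition p c) - int c)"

definition is_core :: "nat \<Rightarrow> (nat \<Rightarrow> nat) \<Rightarrow> bool" where
  "is_core s p \<longleftrightarrow>
     is_partition p \<and> \<not> (\<exists>(r, c) \<in> young_diagram p. hook_length p r c = int s)"

definition remove_hook :: "nat \<Rightarrow> (nat \<Rightarrow> nat) \<Rightarrow> (nat \<Rightarrow> nat) \<Rightarrow> bool" where
  "remove_hook t p q \<longleftrightarrow> is_partition p \<and> is_partition q \<and>
     (\<exists>(r, c) \<in> young_diagram p. hook_length p r c = int t \<and>
        young_diagram q = young_diagram p - rim_hook p r c)"

definition core_of :: "nat \<Rightarrow> (nat \<Rightarrow> nat) \<Rightarrow> (nat \<Rightarrow> nat)" where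
  "core_of t p = (THE q. (remove_hook t)\<^sup>*\<^sup>* p q \<and> is_core t q)"

definition beta_set :: "(nat \<Rightarrow> nat) \<Rightarrow> int set" where
  "beta_set p = {int (p i) - int i | i. i \<ge> 1}"

(* GREATEST rather than Max, because the set in question is infinite (but bounded above). *)
definition core_a :: "nat \<Rightarrow> int \<Rightarrow> (nat \<Rightarrow> nat) \<Rightarrow> int" where
  "core_a s i p = int s + (GREATEST m. m \<in> beta_set p \<and> [m = i] (mod int s))"

definition s_set :: "nat \<Rightarrow> (nat \<Rightarrow> nat) \<Rightarrow> int set" where
  "s_set s p = range (\<lambda>i. core_a s i p)"

definition G_group :: "nat \<Rightarrow> nat \<Rightarrow> (int \<Rightarrow> int) monoid" where
  "G_group s t =
     \<lparr> carrier = {f. bij f \<and> (\<forall>m. f (m + int s) = f m + int s)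
                   \<and> (\<Sum>i = 0..<int s. f i) = int (s choose 2)
                   \<and> (\<forall>m. [f m = m] (mod int t))},
       monoid.mult = (\<circ>), one = id \<rparr>"

definition G_action :: "nat \<Rightarrow> (int \<Rightarrow> int) \<Rightarrow> (nat \<Rightarrow> nat) \<Rightarrow> (nat \<Rightarrow> nat)" where
  "G_action s f p = (THE q. is_core s q \<and> s_set s q = f ` s_set s p)"

definition k_shift :: "nat \<Rightarrow> nat \<Rightarrow> int" where
  "k_shift s t = ((int s + 1) * (int t - 1)) div 2"

lemma k_shift_exact:
  assumes "coprime s t"
  shows "2 * k_shift s t = (int s + 1) * (int t - 1)"
proof -
  have "odd s \<or> odd t"
    using assms by (meson coprime_common_divisor_nat odd_one coprime_common_divisor)
  then have "even ((int s + 1) * (int t - 1))" by auto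
  then show ?thesis unfolding k_shift_def by (rule dvd_mult_div_cancel)
qed

definition core_z :: "nat \<Rightarrow> nat \<Rightarrow> int \<Rightarrow> (nat \<Rightarrow> nat) \<Rightarrow> rat" where
  "core_z s t j q = (1 / of_nat t) *
     of_int (core_a t (int s * j + k_shift s t) q
             - (core_a t (int s * (j + 1) + k_shift s t) q - int s))"

definition core_w :: "nat \<Rightarrow> nat \<Rightarrow> int \<Rightarrow> (nat \<Rightarrow> nat) \<Rightarrow> rat" where
  "core_w s t j q = of_int (core_a t j q - (core_a t (j + int s) q - int s)) / of_nat t"

(* Only meaningful for x in Nats. *)
definition rat_fact :: "rat \<Rightarrow> nat" where
  "rat_fact x = fact (nat \<lfloor>x\<rfloor>)"

end

theory Submission
  imports Defs "HOL-Combinatorics.Permutations"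
begin

text \<open>Removing a rim hook of length \<open>t\<close> replaces an element \<open>x\<close> of the beta-set by \<open>x - t\<close>, so
  it does not change the number of elements \<open>\<ge> N\<close> of the beta-set in a residue class modulo \<open>t\<close>
  (for \<open>N\<close> very negative).  In a \<open>t\<close>-core these numbers determine the values \<open>a\<^sub>t\<^sub>,\<^sub>i\<close>, which gives
  uniqueness of the \<open>t\<close>-core, and \<open>a\<^sub>t\<^sub>,\<^sub>i - a\<^sub>t\<^sub>,\<^sub>i\<^sub>+\<^sub>s + s\<close> is \<open>t\<close> times the difference of the
  counts of \<open>B\<close> and \<open>B - s\<close> in the class of \<open>i\<close>, where \<open>B\<close> is the beta-set of the given partition.
  Since that partition is an \<open>s\<close>-core, \<open>B - s \<subseteq> B\<close>, and \<open>B - (B - s)\<close> is the s-set shifted by \<open>-s\<close>.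
  The stabilizer is isomorphic to the group of permutations of the s-set that preserve residues
  modulo \<open>t\<close>, a product of symmetric groups.\<close>

section \<open>Beta-sets and rim hooks\<close>

lemma beta_setI: "1 \<le> i \<Longrightarrow> int (p i) - int i \<in> beta_set p"
  unfolding beta_set_def by blast

lemma beta_setE:
  assumes "m \<in> beta_set p"
  obtains i where "1 \<le> i" "m = int (p i) - int i"
  using assms unfolding beta_set_def by blast

lemma partition_antimono:
  assumes "is_partition p" "1 \<le> i" "i \<le> j"
  shows "p j \<le> p i"
  using assms(3)
proof (induction j rule: dec_induct)
  case (step n)
  have "p (Suc n) \<le> p n"
    using assms(1,2) step(1) unfolding is_partition_def by simp
  then show ?case using step by linarith
qed simp

lemma partition_eventually_zero:
  assumes "is_partition p"
  obtains n where "\<And>i. n \<le> i \<Longrightarrow> p i = 0"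
proof -
  have "finite {i. p i \<noteq> 0}" using assms unfolding is_partition_def by blast
  then obtain n where "\<forall>i\<in>{i. p i \<noteq> 0}. i < n"
    using finite_nat_set_iff_bounded by blast
  then show thesis using that[of n] by (metis mem_Collect_eq not_less)
qed

lemma beta_strict_decreasing:
  assumes "is_partition p" "1 \<le> i" "i < j"
  shows "int (p j) - int j < int (p i) - int i"
  using partition_antimono[OF assms(1,2), of j] assms(3) by linarith

lemma beta_le_first:
  assumes "is_partition p" "m \<in> beta_set p"
  shows "m < int (p 1)"
proof -
  obtain i where i: "1 \<le> i" "m = int (p i) - int i" using assms(2) by (rule beta_setE)
  show ?thesis using partition_antimono[OF assms(1), of 1 i] i by linarith
qed

lemma beta_finite_above:
  assumes "is_partition p"
  shows "finite (beta_set p \<inter> {N..})"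
  by (rule finite_subset[of _ "{N..int (p 1)}"]) (use beta_le_first[OF assms] in force, simp)

text \<open>Beyond the support of \<open>p\<close> row \<open>i\<close> contributes
  \<open>- i\<close>. So for large \<open>n\<close> the rows after \<open>n\<close> fill exactly the
  integers below \<open>- n\<close>, while the rows \<open>1..n\<close> give \<open>n\<close>
  distinct elements that are at least \<open>- n\<close>. This normalization separates beta-sets of
  partitions from their translates.\<close>

lemma beta_charge:
  assumes "is_partition p"
  obtains n0 where "\<And>n. n0 \<le> n \<Longrightarrow> {..<- int n} \<subseteq> beta_set p"
    and "\<And>n. n0 \<le> n \<Longrightarrow> card (beta_set p \<inter> {- int n..}) = n"
proof -
  obtain n0 where n0: "\<And>i. n0 \<le> i \<Longrightarrow> p i = 0"
    using partition_eventually_zero[OF assms] by blast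
  have sub: "{..<- int n} \<subseteq> beta_set p" if "n0 \<le> n" for n
  proof
    fix m assume "m \<in> {..<- int n}"
    then have "m = int (p (nat (- m))) - int (nat (- m))" "1 \<le> nat (- m)"
      using n0[of "nat (- m)"] that by auto
    then show "m \<in> beta_set p" using beta_setI by metis
  qed
  have "card (beta_set p \<inter> {- int n..}) = n" if n: "n0 \<le> n" for n
  proof -
    have "beta_set p \<inter> {- int n..} = (\<lambda>i. int (p i) - int i) ` {1..n}"
    proof
      show "beta_set p \<inter> {- int n..} \<subseteq> (\<lambda>i. int (p i) - int i) ` {1..n}"
      proof
        fix m assume m: "m \<in> beta_set p \<inter> {- int n..}"
        then obtain i where i: "1 \<le> i" "m = int (p i) - int i" by (blast elim: beta_setE)
        have "i \<le> n" using n0[of i] n i m by (cases "n0 \<le> i") auto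
        then show "m \<in> (\<lambda>i. int (p i) - int i) ` {1..n}" using i by auto
      qed
      show "(\<lambda>i. int (p i) - int i) ` {1..n} \<subseteq> beta_set p \<inter> {- int n..}"
        using beta_setI by fastforce
    qed
    moreover have "inj_on (\<lambda>i. int (p i) - int i) {1..n}"
      by (rule linorder_inj_onI) (use beta_strict_decreasing[OF assms] in force)+
    ultimately show ?thesis by (simp add: card_image)
  qed
  then show thesis using that sub by blast
qed

text \<open>The sequence \<open>int (p i) - int i\<close> lists the beta-set in decreasing order, so
  its \<open>i\<close>-th value is the \<open>i\<close>-th largest element. Index 0 is covered by
  the convention \<open>p 0 = 0\<close>.\<close>

lemma beta_set_inject:
  assumes p: "is_partition p" and q: "is_partition q" and eq: "beta_set p = beta_set q"
  shows "p = q"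
proof -
  have le: "int (p i) - int i \<le> int (q i) - int i"
    if p: "is_partition p" and q: "is_partition q" and eq: "beta_set p = beta_set q"
      and i: "1 \<le> i" and IH: "\<And>j. j < i \<Longrightarrow> p j = q j" for p q i
  proof -
    obtain j where j: "1 \<le> j" "int (p i) - int i = int (q j) - int j"
      using beta_setI[OF i, of p] eq by (metis beta_setE)
    have "i \<le> j"
    proof (rule ccontr)
      assume "\<not> i \<le> j"
      then show False
        using beta_strict_decreasing[OF p j(1), of i] IH[of j] j by simp
    qed
    then show ?thesis
      using beta_strict_decreasing[OF q i, of j] j by (cases "i = j") auto
  qed
  have "p i = q i" for i
  proof (induction i rule: less_induct)
    case (less i)
    show ?case
    proof (cases "i = 0")
      case True
      then show ?thesis using p q unfolding is_partition_def by simp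
    next
      case False
      then show ?thesis
        using le[OF p q eq, of i] le[OF q p eq[symmetric], of i] less by fastforce
    qed
  qed
  then show ?thesis by blast
qed

section \<open>Column lengths, gaps and hook lengths\<close>

text \<open>By monotonicity the rows of length at least \<open>c\<close> form an initial segment of
  the positive integers, and the conjugate part is the length of that segment.\<close>

lemma le_conjugate_iff:
  assumes "is_partition p" "1 \<le> r" "1 \<le> c"
  shows "r \<le> conjugate_partition p c \<longleftrightarrow> c \<le> p r"
proof -
  let ?A = "{i. 1 \<le> i \<and> c \<le> p i}"
  obtain n where n: "\<And>i. n \<le> i \<Longrightarrow> p i = 0"
    using partition_eventually_zero[OF assms(1)] by blast
  have "?A \<subseteq> {..<n}"
  proof
    fix i assume "i \<in> ?A"
    then show "i \<in> {..<n}" using n[of i] assms(3) by (cases "n \<le> i") auto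
  qed
  then have fin: "finite ?A" using finite_subset by blast
  have conj: "conjugate_partition p c = card ?A"
    unfolding conjugate_partition_def by simp
  show ?thesis
  proof
    assume "c \<le> p r"
    then have "{1..r} \<subseteq> ?A" using partition_antimono[OF assms(1)] by fastforce
    from card_mono[OF fin this] show "r \<le> conjugate_partition p c" using conj by simp
  next
    assume r: "r \<le> conjugate_partition p c"
    show "c \<le> p r"
    proof (rule ccontr)
      assume "\<not> c \<le> p r"
      then have "i < r" if "i \<in> ?A" for i
        using partition_antimono[OF assms(1,2), of i] that by (cases "i < r") auto
      then have "?A \<subseteq> {1..<r}" by force
      from card_mono[OF _ this] have "card ?A \<le> r - 1" by simp
      then show False using r conj assms(2) by linarith
    qed
  qed
qed

text \<open>The complement of the beta-set is enumerated by the numbers \<open>c - 1 - \<lambda>'\<^sub>c\<close>, so hook lengths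
  are differences of beads and gaps.\<close>

definition gap :: "(nat \<Rightarrow> nat) \<Rightarrow> nat \<Rightarrow> int" where
  "gap p c = int c - 1 - int (conjugate_partition p c)"

lemma hook_length_gap: "hook_length p r c = (int (p r) - int r) - gap p c"
  unfolding hook_length_def gap_def by simp

lemma gap_less_beta:
  assumes "is_partition p" "1 \<le> r" "1 \<le> c" "c \<le> p r"
  shows "gap p c < int (p r) - int r"
  using le_conjugate_iff[OF assms(1-3)] assms(4) unfolding gap_def by linarith

lemma beta_less_gap:
  assumes "is_partition p" "1 \<le> r" "1 \<le> c" "\<not> c \<le> p r"
  shows "int (p r) - int r < gap p c"
  using le_conjugate_iff[OF assms(1-3)] assms(4) unfolding gap_def by linarith

text \<open>Each row's bead (its element of the beta-set) lies strictly above or strictly below the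
  gap of column \<open>c\<close>, according to whether the row reaches that column.\<close>

lemma gap_notin_beta:
  assumes "is_partition p" "1 \<le> c"
  shows "gap p c \<notin> beta_set p"
proof
  assume "gap p c \<in> beta_set p"
  then obtain r where "1 \<le> r" "gap p c = int (p r) - int r" by (rule beta_setE)
  then show False
    using gap_less_beta[OF assms(1) _ assms(2), of r] beta_less_gap[OF assms(1) _ assms(2), of r]
    by force
qed

lemma conjugate_eqI:
  assumes "is_partition p" "1 \<le> c"
    and "\<And>i. 1 \<le> i \<Longrightarrow> c \<le> p i \<longleftrightarrow> i \<le> l"
  shows "conjugate_partition p c = l"
proof -
  have iff: "i \<le> conjugate_partition p c \<longleftrightarrow> i \<le> l" if "1 \<le> i" for i
    using le_conjugate_iff[OF assms(1) that assms(2)] assms(3)[OF that] by simp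
  show ?thesis
    using iff[of "conjugate_partition p c"] iff[of l] iff[of 1]
    by (cases "l = 0"; cases "conjugate_partition p c = 0") auto
qed

text \<open>Let \<open>r\<close> be the first row whose bead lies below \<open>m\<close>. Then
  column \<open>m + r\<close> has exactly \<open>r - 1\<close> cells, and its gap is therefore
  \<open>m\<close>.\<close>

lemma notin_beta_gap:
  assumes p: "is_partition p" and m: "m \<notin> beta_set p"
  obtains c where "1 \<le> c" "m = gap p c"
proof -
  obtain n where n: "\<And>i. n \<le> i \<Longrightarrow> p i = 0"
    using partition_eventually_zero[OF p] by blast
  let ?P = "\<lambda>i. 1 \<le> i \<and> int (p i) - int i < m"
  \<comment> \<open>This row lies past the support, where row \<open>i\<close> has bead
    \<open>- i\<close>, and its index exceeds \<open>- m\<close>; hence the least such row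
    exists.\<close>
  have "?P (n + 1 + nat (- m))" using n[of "n + 1 + nat (- m)"] by simp
  then have Pr: "?P (LEAST i. ?P i)" by (rule LeastI)
  define r where "r = (LEAST i. ?P i)"
  have r: "1 \<le> r" "int (p r) - int r < m" using Pr unfolding r_def by auto
  have above: "m < int (p i) - int i" if "1 \<le> i" "i < r" for i
  proof -
    have "\<not> ?P i" using not_less_Least[of i ?P] that(2) unfolding r_def by blast
    moreover have "int (p i) - int i \<noteq> m" using beta_setI[OF that(1), of p] m by metis
    ultimately show ?thesis using that(1) by linarith
  qed
  define c where "c = nat (m + int r)"
  have c: "1 \<le> c" "int c = m + int r" using r unfolding c_def by auto
  have "conjugate_partition p c = r - 1"
  proof (rule conjugate_eqI[OF p c(1)])
    fix i :: nat assume i: "1 \<le> i"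
    show "c \<le> p i \<longleftrightarrow> i \<le> r - 1"
    proof
      assume "c \<le> p i"
      then have "\<not> r \<le> i" using partition_antimono[OF p r(1), of i] r(2) c(2) by linarith
      then show "i \<le> r - 1" by simp
    next
      assume ir: "i \<le> r - 1"
      have "int (p (r - 1)) > m + int (r - 1)" using above[of "r - 1"] i ir by linarith
      then show "c \<le> p i" using partition_antimono[OF p i ir] c(2) i ir by linarith
    qed
  qed
  then have "m = gap p c" using c r(1) unfolding gap_def by simp
  then show thesis using that c(1) by blast
qed

text \<open>A hook of length \<open>s\<close> amounts to a bead \<open>m\<close> with a gap at
  \<open>m - s\<close>: the bead gives the row of its corner and the gap gives the column.\<close>

lemma is_core_iff_beta:
  assumes p: "is_partition p" and s: "1 \<le> s"
  shows "is_core s p \<longleftrightarrow> (\<forall>m\<in>beta_set p. m - int s \<in> beta_set p)"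
proof
  assume core: "is_core s p"
  show "\<forall>m\<in>beta_set p. m - int s \<in> beta_set p"
  proof (intro ballI, rule ccontr)
    fix m assume m: "m \<in> beta_set p" "m - int s \<notin> beta_set p"
    obtain r where r: "1 \<le> r" "m = int (p r) - int r" using m(1) by (rule beta_setE)
    obtain c where c: "1 \<le> c" "m - int s = gap p c" using notin_beta_gap[OF p m(2)] by blast
    have "c \<le> p r" using beta_less_gap[OF p r(1) c(1)] r c s by force
    then have "(r, c) \<in> young_diagram p" using r c unfolding young_diagram_def by simp
    moreover have "hook_length p r c = int s" using hook_length_gap[of p r c] r c by simp
    ultimately show False using core unfolding is_core_def by blast
  qed
next
  assume B: "\<forall>m\<in>beta_set p. m - int s \<in> beta_set p"
  have "hook_length p r c \<noteq> int s" if "(r, c) \<in> young_diagram p" for r c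
  proof
    assume "hook_length p r c = int s"
    then have eq: "int (p r) - int r - int s = gap p c" using hook_length_gap[of p r c] by simp
    have rc: "1 \<le> r" "1 \<le> c" using that unfolding young_diagram_def by auto
    show False using B beta_setI[OF rc(1), of p] gap_notin_beta[OF p rc(2)] eq by metis
  qed
  then show "is_core s p" using p unfolding is_core_def by auto
qed

section \<open>Rim hook removal on diagrams and beta-sets\<close>

lemma young_diagram_inject:
  assumes "is_partition p" "is_partition q" "young_diagram p = young_diagram q"
  shows "p = q"
proof
  fix i
  show "p i = q i"
  proof (cases "i = 0")
    case True
    then show ?thesis using assms(1,2) unfolding is_partition_def by simp
  next
    case False
    have "c \<le> p i \<longleftrightarrow> c \<le> q i" if "1 \<le> c" for c
    proof -
      have "(i, c) \<in> young_diagram p \<longleftrightarrow> (i, c) \<in> young_diagram q" using assms(3) by simp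
      then show ?thesis using False that unfolding young_diagram_def by simp
    qed
    from this[of "p i"] this[of "q i"] show ?thesis
      by (cases "p i = 0"; cases "q i = 0") auto
  qed
qed

lemma finite_young_diagram:
  assumes "is_partition p"
  shows "finite (young_diagram p)"
proof -
  obtain n where n: "\<And>i. n \<le> i \<Longrightarrow> p i = 0"
    using partition_eventually_zero[OF assms] by blast
  have "young_diagram p \<subseteq> {..n} \<times> {..p 1}"
  proof
    fix x assume "x \<in> young_diagram p"
    then obtain r c where x: "x = (r, c)" "1 \<le> r" "1 \<le> c" "c \<le> p r"
      unfolding young_diagram_def by auto
    have "r \<le> n" using n[of r] x by (cases "n \<le> r") auto
    moreover have "c \<le> p 1" using partition_antimono[OF assms, of 1 r] x by linarith
    ultimately show "x \<in> {..n} \<times> {..p 1}" using x by simp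
  qed
  then show ?thesis using finite_subset by blast
qed

text \<open>Removing the rim hook of \<open>(r, c)\<close> shifts rows \<open>r + 1, \<dots>, \<lambda>'\<^sub>c\<close> up by one row and left by one
  column, and cuts row \<open>\<lambda>'\<^sub>c\<close> to length \<open>c - 1\<close>.\<close>

definition strip_hook :: "(nat \<Rightarrow> nat) \<Rightarrow> nat \<Rightarrow> nat \<Rightarrow> nat \<Rightarrow> nat" where
  "strip_hook p r c i =
     (if r \<le> i \<and> i < conjugate_partition p c then p (Suc i) - 1
      else if i = conjugate_partition p c then c - 1 else p i)"

context
  fixes p r c
  assumes p: "is_partition p" and r: "1 \<le> r" and c: "1 \<le> c" and rc: "c \<le> p r"
begin

lemma le_leg: "r \<le> conjugate_partition p c"
  using le_conjugate_iff[OF p r c] rc by simp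

lemma le_leg_iff: "1 \<le> i \<Longrightarrow> i \<le> conjugate_partition p c \<longleftrightarrow> c \<le> p i"
  using le_conjugate_iff[OF p _ c] by simp

lemma strip_hook_partition: "is_partition (strip_hook p r c)"
proof -
  let ?l = "conjugate_partition p c"
  have step: "strip_hook p r c (Suc i) \<le> strip_hook p r c i" if i: "1 \<le> i" for i
  proof -
    note mono = partition_antimono[OF p i, of "Suc i"] partition_antimono[OF p, of "Suc i" "Suc (Suc i)"]
    note leg = le_leg_iff[OF i] le_leg_iff[of "Suc i"] le_leg_iff[of "Suc (Suc i)"] le_leg
    show ?thesis unfolding strip_hook_def using mono leg by auto
  qed
  obtain n where n: "\<And>i. n \<le> i \<Longrightarrow> p i = 0"
    using partition_eventually_zero[OF p] by blast
  have "{i. strip_hook p r c i \<noteq> 0} \<subseteq> {..n + ?l}"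
  proof
    fix i assume "i \<in> {i. strip_hook p r c i \<noteq> 0}"
    then show "i \<in> {..n + ?l}" using n[of i]
      by (cases "n + ?l < i") (auto simp: strip_hook_def)
  qed
  then have "finite {i. strip_hook p r c i \<noteq> 0}" using finite_subset by blast
  moreover have "strip_hook p r c 0 = 0"
    using r le_leg p unfolding strip_hook_def is_partition_def by simp
  ultimately show ?thesis using step unfolding is_partition_def by blast
qed

lemma strip_hook_diagram: "young_diagram (strip_hook p r c) = young_diagram p - rim_hook p r c"
proof -
  have "(i, j) \<in> young_diagram (strip_hook p r c) \<longleftrightarrow> (i, j) \<in> young_diagram p - rim_hook p r c"
    for i j
  proof (cases "1 \<le> i \<and> 1 \<le> j")
    case True
    then have ij: "1 \<le> i" "1 \<le> j" by auto
    note mono = partition_antimono[OF p ij(1), of "Suc i"]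
    note leg = le_leg_iff[OF ij(1)] le_leg_iff[of "Suc i"] le_leg
    show ?thesis
      unfolding strip_hook_def young_diagram_def rim_hook_def using ij mono leg c by auto
  next
    case False
    then show ?thesis unfolding young_diagram_def by auto
  qed
  then show ?thesis by auto
qed

text \<open>Moving a row up by one while shortening it by one cell preserves its bead. Hence rows
  \<open>r + 1\<close> up to the end of the leg keep their beads under a new index, the bead of row
  \<open>r\<close> is lost, and the cut row acquires the bead \<open>gap p c\<close>.\<close>

lemma strip_hook_beta:
  "beta_set (strip_hook p r c) = insert (gap p c) (beta_set p - {int (p r) - int r})"
proof -
  let ?l = "conjugate_partition p c" and ?q = "strip_hook p r c"
  let ?x = "\<lambda>i. int (p i) - int i"
  have shift: "int (?q i) - int i = ?x (Suc i)" if "r \<le> i" "i < ?l" for i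
    using that le_leg_iff[of "Suc i"] c unfolding strip_hook_def by auto
  have last: "int (?q ?l) - int ?l = gap p c"
    using c unfolding strip_hook_def gap_def by auto
  have other: "int (?q i) - int i = ?x i" if "i < r \<or> ?l < i" for i
    using that le_leg unfolding strip_hook_def by auto
  have inj: "?x i \<noteq> ?x r" if "1 \<le> i" "i \<noteq> r" for i
    using beta_strict_decreasing[OF p that(1), of r] beta_strict_decreasing[OF p r, of i] that(2)
    by (cases "i < r") auto
  show ?thesis
  proof (intro equalityI subsetI)
    fix m assume "m \<in> beta_set ?q"
    then obtain i where i: "1 \<le> i" "m = int (?q i) - int i" by (rule beta_setE)
    consider "r \<le> i" "i < ?l" | "i = ?l" | "i < r \<or> ?l < i" by linarith
    then show "m \<in> insert (gap p c) (beta_set p - {?x r})"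
    proof cases
      case 1
      then have "m = ?x (Suc i)" using shift i by simp
      then show ?thesis using inj[of "Suc i"] beta_setI[of "Suc i" p] 1 by simp
    next
      case 2
      then show ?thesis using i last by simp
    next
      case 3
      then show ?thesis using other[OF 3] i inj[of i] beta_setI[of i p] le_leg by auto
    qed
  next
    fix m assume m: "m \<in> insert (gap p c) (beta_set p - {?x r})"
    have *: "m \<in> beta_set ?q" if "1 \<le> i" "int (?q i) - int i = m" for i
      using beta_setI[OF that(1), of ?q] that(2) by simp
    show "m \<in> beta_set ?q"
    proof (cases "m = gap p c")
      case True
      then show ?thesis using *[of ?l] last le_leg r by simp
    next
      case False
      then have mx: "m \<in> beta_set p" "m \<noteq> ?x r" using m by auto
      obtain i where i: "1 \<le> i" "m = ?x i" using mx(1) by (rule beta_setE)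
      show ?thesis
      proof (cases "r < i \<and> i \<le> ?l")
        case True
        then show ?thesis using *[of "i - 1"] shift[of "i - 1"] i r by auto
      next
        case False
        moreover have "i \<noteq> r" using mx i by auto
        ultimately show ?thesis using *[of i] other[of i] i by force
      qed
    qed
  qed
qed

end

text \<open>\<open>remove_hook\<close> specifies \<open>q\<close> through its diagram. A diagram
  determines its partition, so \<open>q\<close> is the explicit \<open>strip_hook\<close>, and hook
  length \<open>t\<close> puts the new bead at distance \<open>t\<close> below the old one.\<close>

lemma remove_hook_beta:
  assumes t: "1 \<le> t" and "remove_hook t p q"
  obtains x where "x \<in> beta_set p" "x - int t \<notin> beta_set p"
    "beta_set q = insert (x - int t) (beta_set p - {x})"
proof -
  obtain r c where p: "is_partition p" and q: "is_partition q" and rc: "(r, c) \<in> young_diagram p"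
    and h: "hook_length p r c = int t" and yd: "young_diagram q = young_diagram p - rim_hook p r c"
    using assms(2) unfolding remove_hook_def by blast
  have rc': "1 \<le> r" "1 \<le> c" "c \<le> p r" using rc unfolding young_diagram_def by auto
  have "q = strip_hook p r c"
    using young_diagram_inject[OF q strip_hook_partition[OF p rc']]
      strip_hook_diagram[OF p rc'] yd by simp
  moreover have "gap p c = int (p r) - int r - int t" using h hook_length_gap[of p r c] by simp
  ultimately show thesis
    using that[of "int (p r) - int r"] strip_hook_beta[OF p rc'] beta_setI[OF rc'(1), of p]
      gap_notin_beta[OF p rc'(2)] by simp
qed

lemma not_core_remove_hook:
  assumes t: "1 \<le> t" and p: "is_partition p" and "\<not> is_core t p"
  obtains q where "remove_hook t p q"
proof -
  obtain r c where rc: "(r, c) \<in> young_diagram p" and h: "hook_length p r c = int t"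
    using assms unfolding is_core_def by blast
  have rc': "1 \<le> r" "1 \<le> c" "c \<le> p r" using rc unfolding young_diagram_def by auto
  have "remove_hook t p (strip_hook p r c)"
    unfolding remove_hook_def
    using p strip_hook_partition[OF p rc'] strip_hook_diagram[OF p rc'] rc h by blast
  then show thesis using that by blast
qed

lemma remove_hook_card:
  assumes "1 \<le> t" "remove_hook t p q"
  shows "card (young_diagram q) < card (young_diagram p)"
proof -
  have pq: "is_partition p" "is_partition q" "young_diagram q \<subseteq> young_diagram p"
    using assms(2) unfolding remove_hook_def by auto
  have "p \<noteq> q"
    using remove_hook_beta[OF assms] assms(1) by (metis insertI1)
  then have "young_diagram q \<subset> young_diagram p"
    using young_diagram_inject[OF pq(1,2)] pq(3) by blast
  then show ?thesis using psubset_card_mono[OF finite_young_diagram[OF pq(1)]] by blast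
qed

text \<open>Every removal strictly decreases the number of cells, so the process stops, and it can
  stop only at a \<open>t\<close>-core.\<close>

lemma core_reachable:
  assumes "1 \<le> t" "is_partition p"
  shows "\<exists>q. (remove_hook t)\<^sup>*\<^sup>* p q \<and> is_core t q"
  using assms(2)
proof (induction "card (young_diagram p)" arbitrary: p rule: less_induct)
  case less
  show ?case
  proof (cases "is_core t p")
    case False
    then obtain q where q: "remove_hook t p q"
      using not_core_remove_hook[OF assms(1) less.prems] by blast
    have "is_partition q" using q unfolding remove_hook_def by blast
    then show ?thesis
      using less.hyps[OF remove_hook_card[OF assms(1) q]] q
      by (meson converse_rtranclp_into_rtranclp)
  qed blast
qed

section \<open>Cores and their counts on residue classes\<close>

lemma beta_initial:
  assumes "is_partition p"
  obtains n where "{..<- int n} \<subseteq> beta_set p"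
  by (rule beta_charge[OF assms]) (use that in blast)

lemma downward_closed_mod:
  fixes B :: "int set"
  assumes "\<forall>m\<in>B. m - int s \<in> B" "x \<in> B"
  shows "x - int s * int k \<in> B"
  using assms(2)
proof (induction k)
  case (Suc k)
  then have "x - int s * int k - int s \<in> B" using assms(1) by blast
  then show ?case by (simp add: algebra_simps)
qed simp

lemma core_a_cong_index:
  assumes "[i = j] (mod int s)"
  shows "core_a s i p = core_a s j p"
proof -
  have "[m = i] (mod int s) \<longleftrightarrow> [m = j] (mod int s)" for m
    using assms by (meson cong_sym cong_trans)
  then show ?thesis unfolding core_a_def by simp
qed

text \<open>The beta-set is bounded above and contains all sufficiently negative integers; for a
  core it is also closed under subtracting \<open>s\<close>. It thus meets every residue class in a
  ray unbounded below, so the \<open>GREATEST\<close> in \<open>core_a\<close> is attained and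
  \<open>core_a\<close> is the first missing position of the class.\<close>

lemma core_a_core:
  assumes s: "1 \<le> s" and core: "is_core s p"
  shows core_a_cong: "[core_a s i p = i] (mod int s)"
    and beta_iff_less_core_a: "m \<in> beta_set p \<longleftrightarrow> m < core_a s m p"
proof -
  have p: "is_partition p" using core unfolding is_core_def by blast
  have closed: "\<forall>m\<in>beta_set p. m - int s \<in> beta_set p" using is_core_iff_beta[OF p s] core by blast
  have ex: "\<exists>M\<in>beta_set p. [M = i] (mod int s) \<and> core_a s i p = int s + M
      \<and> (\<forall>m\<in>beta_set p. [m = i] (mod int s) \<longrightarrow> m \<le> M)" for i
  proof -
    obtain n0 where n0: "\<And>n. n0 \<le> n \<Longrightarrow> {..<- int n} \<subseteq> beta_set p"
      using beta_charge[OF p] by blast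
    \<comment> \<open>\<open>X\<close> is chosen so that \<open>m0\<close>, a member of the class of
      \<open>i\<close>, falls into the range where the beta-set is full. Only the finitely many
      beads from \<open>m0\<close> upwards then compete for the maximum.\<close>
    define X where "X = \<bar>i\<bar> + int n0 + 1"
    define m0 where "m0 = i - int s * X"
    have "1 * X \<le> int s * X"
      by (rule mult_right_mono) (use s in \<open>auto simp: X_def\<close>)
    then have "m0 < - int n0" unfolding m0_def X_def[symmetric] using X_def by linarith
    then have "m0 \<in> {..<- int n0}" by simp
    then have m0: "m0 \<in> beta_set p" using n0[of n0] by blast
    have m0c: "[m0 = i] (mod int s)" unfolding m0_def by (simp add: cong_iff_dvd_diff)
    let ?A = "{m \<in> beta_set p \<inter> {m0..}. [m = i] (mod int s)}"
    have fin: "finite ?A" by (rule finite_subset[OF _ beta_finite_above[OF p, of m0]]) blast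
    have ne: "?A \<noteq> {}" using m0 m0c by blast
    have in_A: "Max ?A \<in> ?A" by (rule Max_in[OF fin ne])
    have greatest: "m \<le> Max ?A" if "m \<in> beta_set p" "[m = i] (mod int s)" for m
    proof (cases "m0 \<le> m")
      case True
      then show ?thesis using Max_ge[OF fin] that by simp
    next
      case False
      then show ?thesis using Max_ge[OF fin, of m0] m0 m0c by simp
    qed
    have "(GREATEST m. m \<in> beta_set p \<and> [m = i] (mod int s)) = Max ?A"
      by (rule Greatest_equality) (use in_A greatest in auto)
    then show ?thesis using in_A greatest unfolding core_a_def by auto
  qed
  show cong: "[core_a s i p = i] (mod int s)" for i
    using ex[of i] by (auto simp: cong_def)
  show "m \<in> beta_set p \<longleftrightarrow> m < core_a s m p"
  proof
    assume "m \<in> beta_set p"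
    then show "m < core_a s m p" using ex[of m] s by force
  next
    assume less: "m < core_a s m p"
    obtain M where M: "M \<in> beta_set p" "[M = m] (mod int s)" "core_a s m p = int s + M"
      using ex[of m] by blast
    obtain k where k: "M - m = int s * k" using M(2) by (auto simp: cong_iff_dvd_diff)
    have "0 < int s * (k + 1)" using less M(3) k by (simp add: algebra_simps)
    then have "0 \<le> k" using s by (simp add: zero_less_mult_iff)
    then have "M - int s * k \<in> beta_set p"
      using downward_closed_mod[OF closed M(1), of "nat k"] by simp
    moreover have "M - int s * k = m" using k by linarith
    ultimately show "m \<in> beta_set p" by simp
  qed
qed

text \<open>Since \<open>core_a\<close> depends only on the class, the right-hand side says
  \<open>m - int s < core_a s m p\<close> and \<open>core_a s m p \<le> m\<close>. As
  \<open>m\<close> and \<open>core_a s m p\<close> are congruent modulo \<open>s\<close>, they must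
  be equal.\<close>

lemma mem_s_set_iff:
  assumes s: "1 \<le> s" and core: "is_core s p"
  shows "m \<in> s_set s p \<longleftrightarrow> m \<notin> beta_set p \<and> m - int s \<in> beta_set p"
proof
  assume "m \<in> s_set s p"
  then obtain i where i: "m = core_a s i p" unfolding s_set_def by blast
  have c: "[m = i] (mod int s)" using core_a_cong[OF assms] i by simp
  have "core_a s m p = m" using core_a_cong_index[OF c] i by simp
  moreover have "core_a s (m - int s) p = core_a s m p"
    by (rule core_a_cong_index) (simp add: cong_iff_dvd_diff)
  ultimately show "m \<notin> beta_set p \<and> m - int s \<in> beta_set p"
    using beta_iff_less_core_a[OF assms, of m] beta_iff_less_core_a[OF assms, of "m - int s"] s
    by simp
next
  assume "m \<notin> beta_set p \<and> m - int s \<in> beta_set p"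
  moreover have "core_a s (m - int s) p = core_a s m p"
    by (rule core_a_cong_index) (simp add: cong_iff_dvd_diff)
  ultimately have le: "core_a s m p \<le> m" "m - int s < core_a s m p"
    using beta_iff_less_core_a[OF assms, of m] beta_iff_less_core_a[OF assms, of "m - int s"]
    by auto
  obtain k where k: "m - core_a s m p = int s * k"
    using core_a_cong[OF assms, of m] by (auto simp: cong_iff_dvd_diff dvd_diff_commute)
  have "int s * 0 \<le> int s * k" "int s * k < int s * 1" using le k by linarith+
  then have "0 \<le> k" "k < 1" using s by (simp_all only: mult_le_cancel_left_pos mult_less_cancel_left_pos)
  then have "k = 0" by simp
  then have "m = core_a s m p" using k by simp
  then show "m \<in> s_set s p" unfolding s_set_def by blast
qed

section \<open>Counting beads in residue classes\<close>

text \<open>With \<open>b\<close> the residue of \<open>i - N\<close>, the members of the class from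
  \<open>N\<close> on are \<open>N + b + int t * k\<close> for \<open>k \<ge> 0\<close>, and
  \<open>a\<close> itself is the one with \<open>k = d\<close>. The correction term depends only on
  \<open>i - N\<close>, so it cancels when two counts with the same difference are compared.\<close>

lemma card_residue_interval:
  fixes t :: nat and a i N :: int
  assumes t: "1 \<le> t" and a: "[a = i] (mod int t)" and le: "N \<le> a"
  shows "int t * int (card {m. N \<le> m \<and> m < a \<and> [m = i] (mod int t)})
    = a - N - (i - N) mod int t"
proof -
  have am: "(a - N) mod int t = (i - N) mod int t" using a by (metis cong_def mod_diff_left_eq)
  define d where "d = (a - N) div int t"
  define b where "b = (i - N) mod int t"
  have b: "0 \<le> b" "b < int t" using t unfolding b_def by auto
  have ab: "a - N = int t * d + b" using am unfolding d_def b_def by (metis mult_div_mod_eq)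
  have d: "0 \<le> d" using le t unfolding d_def by (simp add: pos_imp_zdiv_nonneg_iff)
  have cong_iff: "[m = i] (mod int t) \<longleftrightarrow> int t dvd (m - N - b)" for m
  proof -
    have "[m = i] (mod int t) \<longleftrightarrow> [m - N = i - N] (mod int t)"
      by (simp add: cong_iff_dvd_diff)
    also have "\<dots> \<longleftrightarrow> [m - N = b] (mod int t)" unfolding b_def by (simp add: cong_def)
    finally show ?thesis by (simp add: cong_iff_dvd_diff)
  qed
  have "{m. N \<le> m \<and> m < a \<and> [m = i] (mod int t)} = (\<lambda>k. N + b + int t * k) ` {0..<d}"
  proof (intro equalityI subsetI)
    fix m assume m: "m \<in> {m. N \<le> m \<and> m < a \<and> [m = i] (mod int t)}"
    then obtain k where k: "m - N - b = int t * k" using cong_iff by blast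
    have "int t * k < int t * d" using m k ab by auto
    then have kd: "k < d" using t by simp
    have "int t * (- 1) < int t * k" using m k b by auto
    then have "- 1 < k" using t by (simp only: mult_less_cancel_left_pos[of "int t"])
    then show "m \<in> (\<lambda>k. N + b + int t * k) ` {0..<d}" using k kd by (auto intro!: image_eqI[of _ _ k])
  next
    fix m assume "m \<in> (\<lambda>k. N + b + int t * k) ` {0..<d}"
    then obtain k where k: "0 \<le> k" "k < d" "m = N + b + int t * k" by auto
    have "int t * k < int t * d" "0 \<le> int t * k" using k t by auto
    then have "N \<le> m" "m < a" using k(3) ab b by linarith+
    moreover have "[m = i] (mod int t)" using k(3) cong_iff by simp
    ultimately show "m \<in> {m. N \<le> m \<and> m < a \<and> [m = i] (mod int t)}" by simp
  qed
  moreover have "inj_on (\<lambda>k. N + b + int t * k) {0..<d}" using t by (auto simp: inj_on_def)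
  ultimately have "card {m. N \<le> m \<and> m < a \<and> [m = i] (mod int t)} = nat d"
    by (simp add: card_image)
  then show ?thesis using ab d unfolding b_def by simp
qed

definition class_count :: "nat \<Rightarrow> int \<Rightarrow> int \<Rightarrow> int set \<Rightarrow> nat" where
  "class_count t N i B = card {m \<in> B. N \<le> m \<and> [m = i] (mod int t)}"

text \<open>The first gaps are an abstract function \<open>a\<close>, so that the count serves both
  for existing cores and for sets built from prescribed positions. The class of \<open>i\<close> is
  filled exactly up to \<open>a i\<close>, which is at least \<open>N\<close>.\<close>

lemma class_count_abacus:
  assumes t: "1 \<le> t" and a: "\<And>i. [a i = i] (mod int t)"
    and per: "\<And>i j. [i = j] (mod int t) \<Longrightarrow> a i = a j"
    and B: "\<And>m. m \<in> B \<longleftrightarrow> m < a m" and N: "{..<N} \<subseteq> B"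
  shows "int t * int (class_count t N i B) = a i - N - (i - N) mod int t"
proof -
  have "a (a i) = a i" by (rule per[OF a])
  then have "a i \<notin> B" using B[of "a i"] by simp
  then have le: "N \<le> a i" using N by force
  have "{m \<in> B. N \<le> m \<and> [m = i] (mod int t)} = {m. N \<le> m \<and> m < a i \<and> [m = i] (mod int t)}"
    using B per by auto
  then show ?thesis
    unfolding class_count_def using card_residue_interval[OF t a le] by simp
qed

lemma class_count_core:
  assumes "1 \<le> t" "is_core t p" "{..<N} \<subseteq> beta_set p"
  shows "int t * int (class_count t N i (beta_set p)) = core_a t i p - N - (i - N) mod int t"
  by (rule class_count_abacus[where a = "\<lambda>i. core_a t i p", OF assms(1) core_a_cong[OF assms(1,2)] core_a_cong_index
        beta_iff_less_core_a[OF assms(1,2)] assms(3)])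

text \<open>The moved bead stays in its class modulo \<open>t\<close>. It also stays at or above the
  cutoff, because its target is a gap and everything below \<open>N\<close> is occupied.\<close>

lemma remove_hook_class_count:
  assumes t: "1 \<le> t" and rh: "remove_hook t p q" and N: "{..<N} \<subseteq> beta_set p"
  shows "{..<N} \<subseteq> beta_set q" "class_count t N i (beta_set q) = class_count t N i (beta_set p)"
proof -
  obtain x where x: "x \<in> beta_set p" "x - int t \<notin> beta_set p"
    "beta_set q = insert (x - int t) (beta_set p - {x})"
    using remove_hook_beta[OF t rh] by blast
  have Nx: "N \<le> x - int t" using x(2) N by force
  then show "{..<N} \<subseteq> beta_set q" using N x(3) t by auto
  have xc: "[x - int t = i] (mod int t) \<longleftrightarrow> [x = i] (mod int t)" by (simp add: cong_def)
  have p: "is_partition p" using rh unfolding remove_hook_def by blast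
  let ?P = "{m \<in> beta_set p. N \<le> m \<and> [m = i] (mod int t)}"
  let ?Q = "{m \<in> beta_set q. N \<le> m \<and> [m = i] (mod int t)}"
  have fin: "finite ?P" by (rule finite_subset[OF _ beta_finite_above[OF p, of N]]) auto
  show "class_count t N i (beta_set q) = class_count t N i (beta_set p)"
  proof (cases "[x = i] (mod int t)")
    case True
    have "N \<le> x" using Nx t by linarith
    then have "x \<in> ?P" using True x(1) by simp
    moreover have "x - int t \<notin> ?P" using x(2) by simp
    moreover have "?Q = insert (x - int t) (?P - {x})"
      unfolding x(3) using xc True Nx by blast
    ultimately have "card ?Q = card ?P"
      using fin by (simp only: card_insert_disjoint finite_Diff card.remove Diff_iff simp_thms)
    then show ?thesis unfolding class_count_def .
  next
    case False
    then have "?Q = ?P" unfolding x(3) using xc by blast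
    then show ?thesis unfolding class_count_def by simp
  qed
qed

lemma remove_hooks_class_count:
  assumes t: "1 \<le> t" and "(remove_hook t)\<^sup>*\<^sup>* p q" and "{..<N} \<subseteq> beta_set p"
  shows "{..<N} \<subseteq> beta_set q
    \<and> class_count t N i (beta_set q) = class_count t N i (beta_set p)"
  using assms(2)
proof (induction rule: rtranclp_induct)
  case base
  then show ?case using assms(3) by simp
next
  case (step q q')
  then show ?case using remove_hook_class_count[OF t step(2)] by simp
qed

lemma core_eqI:
  assumes s: "1 \<le> s" and "is_core s p" "is_core s q" "\<And>i. core_a s i p = core_a s i q"
  shows "p = q"
proof (rule beta_set_inject)
  show "is_partition p" "is_partition q" using assms unfolding is_core_def by auto
  show "beta_set p = beta_set q"
    using beta_iff_less_core_a[OF s assms(2)] beta_iff_less_core_a[OF s assms(3)] assms(4) by auto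
qed

text \<open>This justifies the \<open>THE\<close> in \<open>core_of\<close>: any two reachable
  \<open>t\<close>-cores have the class counts of \<open>p\<close>, and these determine every
  \<open>core_a\<close>, hence the core.\<close>

lemma core_of_props:
  assumes t: "1 \<le> t" and p: "is_partition p"
  shows "(remove_hook t)\<^sup>*\<^sup>* p (core_of t p)" "is_core t (core_of t p)"
proof -
  obtain q where q: "(remove_hook t)\<^sup>*\<^sup>* p q" "is_core t q"
    using core_reachable[OF t p] by blast
  obtain n where N: "{..<- int n} \<subseteq> beta_set p" using beta_initial[OF p] .
  have "q' = q" if q': "(remove_hook t)\<^sup>*\<^sup>* p q'" "is_core t q'" for q'
  proof (rule core_eqI[OF t q'(2) q(2)])
    fix i
    note rq = remove_hooks_class_count[OF t q(1) N, of i]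
    note rq' = remove_hooks_class_count[OF t q'(1) N, of i]
    show "core_a t i q' = core_a t i q"
      using class_count_core[OF t q(2), of "- int n" i]
        class_count_core[OF t q'(2), of "- int n" i] rq rq' by simp
  qed
  then have "core_of t p = q" unfolding core_of_def using q by blast
  then show "(remove_hook t)\<^sup>*\<^sup>* p (core_of t p)" "is_core t (core_of t p)" using q by auto
qed

text \<open>Shifting index and cutoff together by \<open>s\<close> makes the correction terms agree,
  so the left side is \<open>t\<close> times a difference of two counts for \<open>p\<close>.
  Translated by \<open>- s\<close>, the beads of the second count lie among those of the first; the
  remaining ones are the shifted \<open>s\<close>-set in the class of \<open>i\<close>.\<close>

lemma core_difference_eq_card:
  assumes s: "1 \<le> s" and t: "1 \<le> t" and core: "is_core s p"
  shows "core_a t i (core_of t p) - (core_a t (i + int s) (core_of t p) - int s)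
    = int t * int (card ((\<lambda>x. x - int s) ` s_set s p \<inter> {m. [m = i] (mod int t)}))"
proof -
  have p: "is_partition p" using core unfolding is_core_def by blast
  have closed: "\<forall>m\<in>beta_set p. m - int s \<in> beta_set p" using is_core_iff_beta[OF p s] core by blast
  note q = core_of_props[OF t p]
  obtain n0 where "{..<- int n0} \<subseteq> beta_set p" using beta_initial[OF p] .
  \<comment> \<open>The extra \<open>- int s\<close> ensures that both cutoffs, \<open>N\<close> and
    \<open>N + int s\<close>, lie in the full range.\<close>
  moreover define N where "N = - int n0 - int s"
  ultimately have N: "{..<N + int s} \<subseteq> beta_set p" "{..<N} \<subseteq> beta_set p" by auto
  note r1 = remove_hooks_class_count[OF t q(1) N(2), of i]
  note r2 = remove_hooks_class_count[OF t q(1) N(1), of "i + int s"]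
  have "core_a t i (core_of t p) - (core_a t (i + int s) (core_of t p) - int s)
    = int t * (int (class_count t N i (beta_set p))
        - int (class_count t (N + int s) (i + int s) (beta_set p)))"
  proof -
    have "int t * int (class_count t N i (beta_set p))
      = core_a t i (core_of t p) - N - (i - N) mod int t"
      using class_count_core[OF t q(2), of N i] r1 by simp
    moreover have "int t * int (class_count t (N + int s) (i + int s) (beta_set p))
      = core_a t (i + int s) (core_of t p) - (N + int s) - (i - N) mod int t"
      using class_count_core[OF t q(2), of "N + int s" "i + int s"] r2 by simp
    ultimately show ?thesis by (simp only: right_diff_distrib)
  qed
  moreover have "int (class_count t N i (beta_set p))
      - int (class_count t (N + int s) (i + int s) (beta_set p))
    = int (card ((\<lambda>x. x - int s) ` s_set s p \<inter> {m. [m = i] (mod int t)}))"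
  proof -
    let ?A = "{m \<in> beta_set p. N \<le> m \<and> [m = i] (mod int t)}"
    let ?B' = "{m \<in> beta_set p. N + int s \<le> m \<and> [m = i + int s] (mod int t)}"
    let ?B = "(\<lambda>m. m - int s) ` ?B'"
    have fin: "finite ?A"
      by (rule finite_subset[OF _ beta_finite_above[OF p, of N]]) auto
    have shift: "[m - int s = i] (mod int t) \<longleftrightarrow> [m = i + int s] (mod int t)" for m
      by (simp add: cong_iff_dvd_diff algebra_simps)
    have sub: "?B \<subseteq> ?A" using closed shift by auto
    have "(\<lambda>x. x - int s) ` s_set s p \<inter> {m. [m = i] (mod int t)} = ?A - ?B"
    proof (intro equalityI subsetI)
      fix m assume "m \<in> (\<lambda>x. x - int s) ` s_set s p \<inter> {m. [m = i] (mod int t)}"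
      then obtain x where "x \<in> s_set s p" "m = x - int s" and mi: "[m = i] (mod int t)" by blast
      then have m: "m \<in> beta_set p" "m + int s \<notin> beta_set p"
        using mem_s_set_iff[OF s core, of x] by auto
      \<comment> \<open>All positions below \<open>N + int s\<close> are beads, so the gap
        \<open>m + int s\<close> forces \<open>m\<close> above the cutoff.\<close>
      have "\<not> m + int s < N + int s" using N(1) m(2) by blast
      then have "N \<le> m" by simp
      moreover have "m \<notin> ?B" using m(2) by auto
      ultimately show "m \<in> ?A - ?B" using m(1) mi by simp
    next
      fix m assume m: "m \<in> ?A - ?B"
      have "m + int s \<notin> beta_set p"
      proof
        assume "m + int s \<in> beta_set p"
        then have "m + int s \<in> ?B'" using m shift[of "m + int s"] by simp
        then have "m + int s - int s \<in> ?B" by (rule imageI)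
        then show False using m by simp
      qed
      then have "m + int s \<in> s_set s p" using m mem_s_set_iff[OF s core, of "m + int s"] by simp
      then have "m + int s - int s \<in> (\<lambda>x. x - int s) ` s_set s p" by (rule imageI)
      then show "m \<in> (\<lambda>x. x - int s) ` s_set s p \<inter> {m. [m = i] (mod int t)}" using m by simp
    qed
    moreover have "card ?B = card ?B'" by (intro card_image) (auto simp: inj_on_def)
    moreover have "card (?A - ?B) = card ?A - card ?B"
      using card_Diff_subset[OF finite_subset[OF sub fin] sub] .
    ultimately show ?thesis
      unfolding class_count_def using card_mono[OF fin sub] by simp
  qed
  ultimately show ?thesis by simp
qed

section \<open>Sums and products over complete residue systems\<close>

text \<open>A map that keeps incongruent integers incongruent induces an injection of the finite set
  of residues into itself. This serves below for translations, for the inverse of a group element,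
  and for multiplication by \<open>s\<close> modulo \<open>t\<close>.\<close>

lemma bij_betw_mod:
  fixes \<sigma> :: "int \<Rightarrow> int"
  assumes s: "1 \<le> s" and inj: "\<And>i j. [\<sigma> i = \<sigma> j] (mod int s) \<Longrightarrow> [i = j] (mod int s)"
  shows "bij_betw (\<lambda>i. \<sigma> i mod int s) {0..<int s} {0..<int s}"
proof -
  have "inj_on (\<lambda>i. \<sigma> i mod int s) {0..<int s}"
  proof (rule inj_onI)
    fix i j assume ij: "i \<in> {0..<int s}" "j \<in> {0..<int s}" "\<sigma> i mod int s = \<sigma> j mod int s"
    then have "[i = j] (mod int s)" using inj unfolding cong_def by blast
    then show "i = j" using ij by (simp add: cong_def)
  qed
  moreover have "(\<lambda>i. \<sigma> i mod int s) ` {0..<int s} \<subseteq> {0..<int s}" using s by auto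
  ultimately show ?thesis
    unfolding bij_betw_def using endo_inj_surj[of "{0..<int s}" "\<lambda>i. \<sigma> i mod int s"] by simp
qed

lemma sum_reindex_mod:
  fixes F :: "int \<Rightarrow> int"
  assumes "1 \<le> s" and "\<And>i j. [\<sigma> i = \<sigma> j] (mod int s) \<Longrightarrow> [i = j] (mod int s)"
    and F: "\<And>i j. [i = j] (mod int s) \<Longrightarrow> F i = F j"
  shows "(\<Sum>i = 0..<int s. F (\<sigma> i)) = (\<Sum>i = 0..<int s. F i)"
proof -
  have "(\<Sum>i = 0..<int s. F (\<sigma> i)) = (\<Sum>i = 0..<int s. F (\<sigma> i mod int s))"
    by (intro sum.cong refl F) (simp add: cong_def)
  moreover have "bij_betw (\<lambda>i. \<sigma> i mod int s) {0..<int s} {0..<int s}"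
    by (rule bij_betw_mod) (fact assms)+
  ultimately show ?thesis using sum.reindex_bij_betw by metis
qed

lemma prod_reindex_mod:
  fixes F :: "int \<Rightarrow> nat"
  assumes "1 \<le> s" and "\<And>i j. [\<sigma> i = \<sigma> j] (mod int s) \<Longrightarrow> [i = j] (mod int s)"
    and F: "\<And>i j. [i = j] (mod int s) \<Longrightarrow> F i = F j"
  shows "(\<Prod>i = 0..<int s. F (\<sigma> i)) = (\<Prod>i = 0..<int s. F i)"
proof -
  have "(\<Prod>i = 0..<int s. F (\<sigma> i)) = (\<Prod>i = 0..<int s. F (\<sigma> i mod int s))"
    by (intro prod.cong refl F) (simp add: cong_def)
  moreover have "bij_betw (\<lambda>i. \<sigma> i mod int s) {0..<int s} {0..<int s}"
    by (rule bij_betw_mod) (fact assms)+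
  ultimately show ?thesis using prod.reindex_bij_betw by metis
qed

section \<open>Cores with a prescribed s-set\<close>

text \<open>This is a converse to \<open>beta_charge\<close>: part \<open>i\<close> is recovered by
  adding \<open>i\<close> to the \<open>i\<close>-th largest element, which is
  \<open>xs ! (n - i)\<close> in the increasing list.\<close>

lemma partition_of_beta_set:
  fixes B :: "int set"
  assumes low: "{..<- int n} \<subseteq> B" and fin: "finite (B \<inter> {- int n..})"
    and card: "card (B \<inter> {- int n..}) = n"
  obtains p where "is_partition p" "beta_set p = B"
proof -
  define xs where "xs = sorted_list_of_set (B \<inter> {- int n..})"
  have len: "length xs = n" unfolding xs_def using card by simp
  have set_xs: "set xs = B \<inter> {- int n..}" unfolding xs_def using fin by simp
  have less: "xs ! i < xs ! j" if "i < j" "j < n" for i j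
    using sorted_wrt_nth_less[OF strict_sorted_list_of_set that(1), of "B \<inter> {- int n..}"] that(2)
      len unfolding xs_def by simp
  \<comment> \<open>This bound makes the argument of \<open>nat\<close> in the definition of
    \<open>p\<close> nonnegative, so no truncation occurs.\<close>
  have lower: "- int n + int j \<le> xs ! j" if "j < n" for j
    using that
  proof (induction j)
    case 0
    then show ?case using nth_mem[of 0 xs] set_xs len by auto
  next
    case (Suc j)
    then show ?case using less[of j "Suc j"] by simp
  qed
  define p where "p i = (if 1 \<le> i \<and> i \<le> n then nat (xs ! (n - i) + int i) else 0)" for i
  have p_in: "int (p i) - int i = xs ! (n - i)" if "1 \<le> i" "i \<le> n" for i
    using lower[of "n - i"] that unfolding p_def by (simp add: of_nat_diff)
  have "p (Suc i) \<le> p i" if "1 \<le> i" for i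
  proof (cases "Suc i \<le> n")
    case True
    then have "xs ! (n - Suc i) < xs ! (n - i)" using less[of "n - Suc i" "n - i"] that by simp
    then show ?thesis using p_in[of i] p_in[of "Suc i"] that True by linarith
  next
    case False
    then show ?thesis unfolding p_def by simp
  qed
  moreover have "finite {i. p i \<noteq> 0}"
    by (rule finite_subset[of _ "{..n}"]) (auto simp: p_def split: if_splits)
  moreover have "p 0 = 0" unfolding p_def by simp
  ultimately have "is_partition p" unfolding is_partition_def by blast
  moreover have "beta_set p = B"
  proof (intro equalityI subsetI)
    fix m assume "m \<in> beta_set p"
    then obtain i where i: "1 \<le> i" "m = int (p i) - int i" by (rule beta_setE)
    show "m \<in> B"
    proof (cases "i \<le> n")
      case True
      then have "m \<in> set xs" using p_in[OF i(1)] i len by simp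
      then show ?thesis using set_xs by blast
    next
      case False
      then have "m < - int n" using i unfolding p_def by simp
      then show ?thesis using low by auto
    qed
  next
    fix m assume m: "m \<in> B"
    show "m \<in> beta_set p"
    proof (cases "m < - int n")
      case True
      then have "1 \<le> nat (- m)" "p (nat (- m)) = 0" "int (nat (- m)) = - m"
        unfolding p_def by auto
      then show ?thesis using beta_setI[of "nat (- m)" p] by simp
    next
      case False
      then have "m \<in> set xs" using m set_xs by simp
      then obtain j where j: "j < n" "m = xs ! j" using len by (metis in_set_conv_nth)
      then show ?thesis using beta_setI[of "n - j" p] p_in[of "n - j"] by simp
    qed
  qed
  ultimately show thesis using that by blast
qed

text \<open>The class counts are added over all residues, and the correction terms run through each
  residue once. For \<open>N = - int n\<close> the count is therefore \<open>n\<close> precisely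
  when the first gaps have the same sum as the residues.\<close>

lemma card_abacus_above:
  assumes s: "1 \<le> s" and a: "\<And>i. [a i = i] (mod int s)"
    and per: "\<And>i j. [i = j] (mod int s) \<Longrightarrow> a i = a j"
    and B: "\<And>m. m \<in> B \<longleftrightarrow> m < a m" and N: "{..<N} \<subseteq> B"
  shows "finite (B \<inter> {N..})"
    and "int s * int (card (B \<inter> {N..})) = (\<Sum>i = 0..<int s. a i) - int s * N - (\<Sum>i = 0..<int s. i)"
proof -
  let ?C = "\<lambda>i. {m \<in> B. N \<le> m \<and> [m = i] (mod int s)}"
  have fin: "finite (?C i)" for i
    by (rule finite_subset[of _ "{N..a i}"]) (use B per in force, simp)
  have un: "B \<inter> {N..} = (\<Union>i\<in>{0..<int s}. ?C i)"
  proof (intro equalityI subsetI)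
    fix m assume "m \<in> B \<inter> {N..}"
    moreover have "m mod int s \<in> {0..<int s}" "[m = m mod int s] (mod int s)"
      using s by (auto simp: cong_def)
    ultimately show "m \<in> (\<Union>i\<in>{0..<int s}. ?C i)" by blast
  qed auto
  show "finite (B \<inter> {N..})" unfolding un using fin by blast
  have "card (\<Union>i\<in>{0..<int s}. ?C i) = (\<Sum>i = 0..<int s. card (?C i))"
  proof (rule card_UN_disjoint)
    show "\<forall>i\<in>{0..<int s}. \<forall>j\<in>{0..<int s}. i \<noteq> j \<longrightarrow> ?C i \<inter> ?C j = {}"
      by (auto simp: cong_def)
  qed (use fin in auto)
  then have "int s * int (card (B \<inter> {N..})) = (\<Sum>i = 0..<int s. int s * int (class_count s N i B))"
    unfolding un class_count_def by (simp add: sum_distrib_left)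
  also have "\<dots> = (\<Sum>i = 0..<int s. a i - N - (i - N) mod int s)"
    by (rule sum.cong[OF refl]) (rule class_count_abacus[where a = a, OF s a per B N])
  also have "\<dots> = (\<Sum>i = 0..<int s. a i) - int s * N - (\<Sum>i = 0..<int s. (i - N) mod int s)"
    by (simp add: sum_subtractf)
  also have "(\<Sum>i = 0..<int s. (i - N) mod int s) = (\<Sum>i = 0..<int s. i mod int s)"
    by (rule sum_reindex_mod[OF s, where F = "\<lambda>i. i mod int s"]) (auto simp: cong_iff_dvd_diff cong_def mod_eq_dvd_iff)
  also have "\<dots> = (\<Sum>i = 0..<int s. i)" by (rule sum.cong) auto
  finally show "int s * int (card (B \<inter> {N..})) = (\<Sum>i = 0..<int s. a i) - int s * N - (\<Sum>i = 0..<int s. i)" .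
qed

lemma sum_core_a:
  assumes s: "1 \<le> s" and core: "is_core s p"
  shows "(\<Sum>i = 0..<int s. core_a s i p) = (\<Sum>i = 0..<int s. i)"
proof -
  have p: "is_partition p" using core unfolding is_core_def by blast
  obtain n where n: "{..<- int n} \<subseteq> beta_set p" "card (beta_set p \<inter> {- int n..}) = n"
    by (rule beta_charge[OF p]) (use that in blast)
  show ?thesis
    using card_abacus_above(2)[where a = "\<lambda>i. core_a s i p", OF s core_a_cong[OF s core]
        core_a_cong_index beta_iff_less_core_a[OF s core] n(1)] n(2) by simp
qed

lemma abacus_initial:
  assumes s: "1 \<le> s" and per: "\<And>i j. [i = j] (mod int s) \<Longrightarrow> a i = a j"
    and B: "\<And>m. m \<in> B \<longleftrightarrow> m < a m"
  obtains n where "{..<- int n} \<subseteq> B"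
proof -
  define n where "n = nat (- Min (a ` {0..<int s}))"
  have "m \<in> B" if "m < - int n" for m
  proof -
    have "a m = a (m mod int s)" by (rule per) (simp add: cong_def)
    moreover have "a (m mod int s) \<ge> Min (a ` {0..<int s})" by (rule Min_le) (use s in auto)
    moreover have "m < Min (a ` {0..<int s})" using that unfolding n_def by linarith
    ultimately show ?thesis using B by simp
  qed
  then show thesis using that by blast
qed

text \<open>The beads are placed below \<open>a\<close> in every class. The sum condition gives this
  set the normalization of a beta-set, and periodicity of \<open>a\<close> makes it closed under
  subtracting \<open>s\<close>. This is the surjectivity of the \<open>s\<close>-set map.\<close>

lemma core_of_abacus:
  assumes s: "1 \<le> s" and a: "\<And>i. [a i = i] (mod int s)"
    and per: "\<And>i j. [i = j] (mod int s) \<Longrightarrow> a i = a j"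
    and sum: "(\<Sum>i = 0..<int s. a i) = (\<Sum>i = 0..<int s. i)"
  obtains q where "is_core s q" "\<And>i. core_a s i q = a i"
proof -
  define B where "B = {m. m < a m}"
  have B: "m \<in> B \<longleftrightarrow> m < a m" for m unfolding B_def by simp
  obtain n where n: "{..<- int n} \<subseteq> B" using abacus_initial[OF s per B] by blast
  have "int s * int (card (B \<inter> {- int n..})) = int s * int n"
    using card_abacus_above(2)[where a = a, OF s a per B n] sum by simp
  then have "card (B \<inter> {- int n..}) = n" using s by simp
  then obtain q where q: "is_partition q" "beta_set q = B"
    using partition_of_beta_set[OF n card_abacus_above(1)[where a = a, OF s a per B n]] by blast
  have shift: "a (m - int s) = a m" for m by (rule per) (simp add: cong_iff_dvd_diff)
  have core: "is_core s q"
    using is_core_iff_beta[OF q(1) s] q(2) B shift by simp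
  have "core_a s i q = a i" for i
  proof -
    have aa: "a (a i) = a i" by (rule per[OF a])
    have "a i \<in> s_set s q"
      using mem_s_set_iff[OF s core, of "a i"] q(2) B[of "a i"] B[of "a i - int s"] aa shift[of "a i"] s
      by simp
    then obtain j where j: "a i = core_a s j q" unfolding s_set_def by blast
    have "[i = j] (mod int s)"
      using j a[of i] core_a_cong[OF s core, of j] by (metis cong_sym cong_trans)
    then show ?thesis using core_a_cong_index j by metis
  qed
  then show thesis using that core by blast
qed

section \<open>The stabilizer\<close>

text \<open>A permutation preserving \<open>h\<close> acts on each fibre separately, and
  permutations of the fibres can be chosen independently; \<open>?split\<close> and
  \<open>?glue\<close> translate between the two descriptions. Indices with empty fibre contribute
  the factor 1.\<close>

lemma card_fibre_permutations:
  fixes h :: "'a \<Rightarrow> 'b"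
  assumes S: "finite S" and J: "finite J" and hS: "h ` S \<subseteq> J"
  shows "card {\<pi>. \<pi> permutes S \<and> (\<forall>x\<in>S. h (\<pi> x) = h x)} = (\<Prod>j\<in>J. fact (card {x \<in> S. h x = j}))"
proof -
  let ?S = "\<lambda>j. {x \<in> S. h x = j}"
  let ?P = "{\<pi>. \<pi> permutes S \<and> (\<forall>x\<in>S. h (\<pi> x) = h x)}"
  let ?Q = "\<Pi>\<^sub>E j\<in>J. {\<pi>. \<pi> permutes ?S j}"
  let ?split = "\<lambda>\<pi>. \<lambda>j\<in>J. \<lambda>x. if x \<in> ?S j then \<pi> x else x"
  let ?glue = "\<lambda>F x. if x \<in> S then F (h x) x else x"
  have fibre: "F (h x) x \<in> ?S (h x)" if "F \<in> ?Q" "x \<in> S" for F x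
  proof -
    have "F (h x) permutes ?S (h x)" using that hS by (auto simp: PiE_iff)
    from permutes_in_image[OF this, of x] show ?thesis using that(2) by simp
  qed
  have "bij_betw ?split ?P ?Q"
  proof (rule bij_betw_byWitness[where f' = ?glue])
    show "\<forall>\<pi>\<in>?P. ?glue (?split \<pi>) = \<pi>"
    proof (intro ballI ext)
      fix \<pi> x assume "\<pi> \<in> ?P"
      then show "?glue (?split \<pi>) x = \<pi> x"
        using permutes_not_in[of \<pi> S x] hS by auto
    qed
    show "\<forall>F\<in>?Q. ?split (?glue F) = F"
    proof (intro ballI ext)
      fix F j x assume F: "F \<in> ?Q"
      show "?split (?glue F) j x = F j x"
      proof (cases "j \<in> J")
        case True
        then have "F j permutes ?S j" using F by (auto simp: PiE_iff)
        then show ?thesis using permutes_not_in[of "F j" "?S j" x] True by auto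
      next
        case False
        then show ?thesis using PiE_arb[OF F False] by simp
      qed
    qed
    show "?split ` ?P \<subseteq> ?Q"
    proof
      fix F assume "F \<in> ?split ` ?P"
      then obtain \<pi> where \<pi>: "\<pi> permutes S" "\<forall>x\<in>S. h (\<pi> x) = h x" "F = ?split \<pi>" by blast
      have "(\<lambda>x. if x \<in> ?S j then \<pi> x else x) permutes ?S j" (is "?\<rho> permutes _") for j
      proof (rule bij_imp_permutes)
        have "inj_on ?\<rho> (?S j)" using permutes_inj[OF \<pi>(1)] by (auto simp: inj_on_def)
        moreover have "?\<rho> ` ?S j \<subseteq> ?S j" using permutes_in_image[OF \<pi>(1)] \<pi>(2) by auto
        ultimately show "bij_betw ?\<rho> (?S j) (?S j)"
          unfolding bij_betw_def using endo_inj_surj[of "?S j" ?\<rho>] S by simp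
      qed auto
      then show "F \<in> ?Q" using \<pi>(3) by (simp add: PiE_iff)
    qed
    show "?glue ` ?Q \<subseteq> ?P"
    proof
      fix \<pi> assume "\<pi> \<in> ?glue ` ?Q"
      then obtain F where F: "F \<in> ?Q" "\<pi> = ?glue F" by blast
      have h\<pi>: "\<pi> x \<in> S" "h (\<pi> x) = h x" if "x \<in> S" for x
        using fibre[OF F(1) that] F(2) that by auto
      have "\<pi> permutes S"
      proof (rule bij_imp_permutes)
        have "inj_on \<pi> S"
        proof (rule inj_onI)
          fix x y assume xy: "x \<in> S" "y \<in> S" "\<pi> x = \<pi> y"
          \<comment> \<open>The glued map preserves \<open>h\<close>, so equal images come from one
            fibre, where a single permutation acts.\<close>
          then have hxy: "h x = h y" using h\<pi> by metis
          then have "F (h y) x = F (h y) y" using xy F(2) by simp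
          moreover have "F (h y) permutes ?S (h y)" using F(1) xy(2) hS by (auto simp: PiE_iff)
          ultimately show "x = y" using permutes_inj injD by metis
        qed
        moreover have "\<pi> ` S \<subseteq> S" using h\<pi> by auto
        ultimately show "bij_betw \<pi> S S"
          unfolding bij_betw_def using endo_inj_surj[OF S] by simp
      qed (use F(2) in auto)
      then show "\<pi> \<in> ?P" using h\<pi>(2) by blast
    qed
  qed
  then have "card ?P = card ?Q" by (rule bij_betw_same_card)
  also have "\<dots> = (\<Prod>j\<in>J. card {\<pi>. \<pi> permutes ?S j})" by (rule card_PiE[OF J])
  also have "\<dots> = (\<Prod>j\<in>J. fact (card (?S j)))"
    by (rule prod.cong[OF refl], rule card_permutations[OF refl]) (use S in auto)
  finally show ?thesis .
qed

lemma periodic_shift: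
  fixes f :: "int \<Rightarrow> int"
  assumes "\<forall>m. f (m + int s) = f m + int s"
  shows "f (m + int s * k) = f m + int s * k"
proof -
  have nat: "f (m + int s * int n) = f m + int s * int n" for m n
  proof (induction n)
    case (Suc n)
    then show ?case using assms[rule_format, of "m + int s * int n"] by (simp add: algebra_simps)
  qed simp
  show ?thesis
  proof (cases "0 \<le> k")
    case True
    then show ?thesis using nat[of m "nat k"] by simp
  next
    case False
    then show ?thesis using nat[of "m + int s * k" "nat (- k)"] by simp
  qed
qed

lemma mem_G_group:
  "f \<in> carrier (G_group s t) \<longleftrightarrow> bij f \<and> (\<forall>m. f (m + int s) = f m + int s)
     \<and> (\<Sum>i = 0..<int s. f i) = int (s choose 2) \<and> (\<forall>m. [f m = m] (mod int t))"
  unfolding G_group_def by simp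

lemma s_set_inject:
  assumes s: "1 \<le> s" and core: "is_core s p" and core': "is_core s q" and eq: "s_set s q = s_set s p"
  shows "q = p"
proof (rule core_eqI[OF s core' core])
  fix i
  have "core_a s i q \<in> s_set s p" using eq unfolding s_set_def by blast
  then obtain j where j: "core_a s i q = core_a s j p" unfolding s_set_def by blast
  have "[i = j] (mod int s)"
    using j core_a_cong[OF s core, of j] core_a_cong[OF s core', of i] by (metis cong_sym cong_trans)
  then show "core_a s i q = core_a s i p" using j core_a_cong_index by metis
qed

lemma sum_residues: "(\<Sum>i = 0..<int s. i) = int (s choose 2)"
proof (induction s)
  case (Suc s)
  have "{0..<int (Suc s)} = insert (int s) {0..<int s}" by auto
  then show ?case using Suc by (simp add: numeral_2_eq_2)
qed simp

context
  fixes s t :: nat and p :: "nat \<Rightarrow> nat"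
  assumes s: "1 \<le> s" and core: "is_core s p"
begin

text \<open>The group element permutes the classes modulo \<open>s\<close>, so the image of the
  \<open>s\<close>-set again has one element in each class. Its sum is unchanged, and
  \<open>core_of_abacus\<close> supplies the core.\<close>

lemma G_action_exists:
  assumes f: "f \<in> carrier (G_group s t)"
  obtains q where "is_core s q" "s_set s q = f ` s_set s p"
proof -
  note fG = f[unfolded mem_G_group]
  have bij: "bij f" and "\<forall>m. f (m + int s) = f m + int s" using fG by auto
  note per_f = periodic_shift[OF this(2)]
  define g where "g = inv_into UNIV f"
  have f_inv: "f (g m) = m" "g (f m) = m" for m
    unfolding g_def using bij by (simp_all add: bij_is_surj surj_f_inv_f bij_is_inj)
  have f_cong: "[f i = f j] (mod int s)" if ij: "[i = j] (mod int s)" for i j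
  proof -
    obtain k where "i = j + int s * k" using ij by (metis cong_iff_lin cong_sym)
    then show ?thesis using per_f by (simp add: cong_iff_dvd_diff)
  qed
  have inv_cong: "[g i = g j] (mod int s)" if ij: "[i = j] (mod int s)" for i j
  proof -
    obtain k where k: "i = j + int s * k" using ij by (metis cong_iff_lin cong_sym)
    have "f (g j + int s * k) = f (g i)" using per_f f_inv k by simp
    then have "g j + int s * k = g i" using bij by (metis bij_is_inj injD)
    then show ?thesis by (metis cong_iff_lin cong_sym)
  qed
  \<comment> \<open>The image element in class \<open>i\<close> comes from the element of the
    \<open>s\<close>-set in the class of the preimage \<open>g i\<close>.\<close>
  define a where "a i = f (core_a s (g i) p)" for i
  have a1: "[a i = i] (mod int s)" for i
    using f_cong[OF core_a_cong[OF s core, of "g i"]] f_inv unfolding a_def by simp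
  have a2: "a i = a j" if "[i = j] (mod int s)" for i j
    unfolding a_def using core_a_cong_index[OF inv_cong[OF that]] by simp
  have "(\<Sum>i = 0..<int s. a i) = (\<Sum>i = 0..<int s. f (core_a s i p))"
    unfolding a_def
  proof (rule sum_reindex_mod[OF s, where F = "\<lambda>i. f (core_a s i p)"])
    show "[i = j] (mod int s)" if "[g i = g j] (mod int s)" for i j
      using f_cong[OF that] f_inv by simp
    show "f (core_a s i p) = f (core_a s j p)" if "[i = j] (mod int s)" for i j
      using core_a_cong_index[OF that] by simp
  qed
  \<comment> \<open>\<open>core_a s i p\<close> differs from \<open>i\<close> by a multiple of
    \<open>s\<close>, which \<open>f\<close> carries through unchanged. The normalizations of
    \<open>f\<close> and of \<open>p\<close> then give the required sum.\<close>
  also have "\<dots> = (\<Sum>i = 0..<int s. f i + (core_a s i p - i))"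
  proof (rule sum.cong[OF refl])
    fix i
    obtain k where k: "core_a s i p = i + int s * k"
      using core_a_cong[OF s core, of i] by (metis cong_iff_lin cong_sym)
    then show "f (core_a s i p) = f i + (core_a s i p - i)" using per_f by simp
  qed
  also have "\<dots> = (\<Sum>i = 0..<int s. i)"
    using fG sum_core_a[OF s core] sum_residues by (simp add: sum.distrib sum_subtractf)
  finally obtain q where q: "is_core s q" "\<And>i. core_a s i q = a i"
    using core_of_abacus[OF s a1 a2] by blast
  have "s_set s q = f ` s_set s p"
  proof -
    have "range a = (\<lambda>i. f (core_a s i p)) ` range (g)"
      unfolding a_def by auto
    moreover have "range (g) = UNIV" using f_inv(2) by (metis surjI)
    ultimately show ?thesis unfolding s_set_def q(2) by auto
  qed
  then show thesis using that q(1) by blast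
qed

text \<open>The core described by \<open>G_action\<close> exists, and it is unique because a core is
  determined by its \<open>s\<close>-set; so fixing \<open>p\<close> can be tested on
  \<open>s\<close>-sets.\<close>

lemma G_action_fixes_iff:
  assumes f: "f \<in> carrier (G_group s t)"
  shows "G_action s f p = p \<longleftrightarrow> f ` s_set s p = s_set s p"
proof
  assume fixed: "G_action s f p = p"
  obtain q where q: "is_core s q" "s_set s q = f ` s_set s p" using G_action_exists[OF f] by blast
  have "G_action s f p = q"
    unfolding G_action_def
  proof (rule the_equality)
    fix q' assume q': "is_core s q' \<and> s_set s q' = f ` s_set s p"
    show "q' = q"
      using s_set_inject[OF s q(1)] q' q(2) by simp
  qed (use q in blast)
  then show "f ` s_set s p = s_set s p" using fixed q by simp
next
  assume "f ` s_set s p = s_set s p"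
  then show "G_action s f p = p"
    unfolding G_action_def using core s_set_inject[OF s core] by (intro the_equality) auto
qed

lemma s_set_residues: "bij_betw (\<lambda>i. core_a s i p) {0..<int s} (s_set s p)"
proof -
  have "inj_on (\<lambda>i. core_a s i p) {0..<int s}"
  proof (rule inj_onI)
    fix i j assume ij: "i \<in> {0..<int s}" "j \<in> {0..<int s}" "core_a s i p = core_a s j p"
    have "[i = j] (mod int s)"
      using core_a_cong[OF s core, of i] core_a_cong[OF s core, of j] ij(3)
      by (metis cong_sym cong_trans)
    then show "i = j" using ij by (simp add: cong_def)
  qed
  moreover have "(\<lambda>i. core_a s i p) ` {0..<int s} = s_set s p"
  proof (intro equalityI subsetI)
    fix m assume "m \<in> s_set s p"
    then obtain i where i: "m = core_a s i p" unfolding s_set_def by blast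
    have "core_a s i p = core_a s (i mod int s) p"
      by (rule core_a_cong_index) (simp add: cong_def)
    then show "m \<in> (\<lambda>i. core_a s i p) ` {0..<int s}" using i s by auto
  qed (auto simp: s_set_def)
  ultimately show ?thesis unfolding bij_betw_def by blast
qed

lemma finite_s_set: "finite (s_set s p)"
  using bij_betw_finite[OF s_set_residues] by simp

text \<open>The s-set is a system of representatives modulo \<open>s\<close>, so an element of the group is determined
  by its restriction to it; conversely every permutation of the s-set extends periodically.\<close>

lemma card_stabilizer:
  "card (stabilizer (G_group s t) (G_action s) p)
    = card {\<pi>. \<pi> permutes s_set s p \<and> (\<forall>x\<in>s_set s p. \<pi> x mod int t = x mod int t)}"
proof -
  let ?S = "s_set s p"
  define r where "r m = core_a s m p" for m
  \<comment> \<open>\<open>r m\<close> is the representative of \<open>m\<close> in the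
    \<open>s\<close>-set and \<open>m - r m\<close> is a multiple of \<open>s\<close>, so this is
    the only possible periodic extension.\<close>
  define extend where "extend \<pi> m = \<pi> (r m) + (m - r m)" for \<pi> :: "int \<Rightarrow> int" and m
  let ?restrict = "\<lambda>f m :: int. if m \<in> ?S then f m else m"
  let ?Stab = "stabilizer (G_group s t) (G_action s) p"
  let ?P = "{\<pi>. \<pi> permutes ?S \<and> (\<forall>x\<in>?S. \<pi> x mod int t = x mod int t)}"
  have Stab: "f \<in> ?Stab \<longleftrightarrow> f \<in> carrier (G_group s t) \<and> f ` ?S = ?S" for f
    unfolding stabilizer_def using G_action_fixes_iff by blast
  have r_S: "r m \<in> ?S" for m unfolding r_def s_set_def by blast
  have r_cong: "[r m = m] (mod int s)" for m unfolding r_def using core_a_cong[OF s core] .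
  have r_eq: "r i = r j" if "[i = j] (mod int s)" for i j
    unfolding r_def using core_a_cong_index[OF that] .
  have r_id: "r m = m" if "m \<in> ?S" for m
  proof -
    obtain i where "m = r i" using \<open>m \<in> ?S\<close> unfolding s_set_def r_def by blast
    then show ?thesis using r_eq[OF r_cong, of i] by simp
  qed
  have r_diff: "\<exists>k. m = r m + int s * k" for m
    using r_cong[of m] by (metis cong_iff_lin)
  have extend_S: "extend \<pi> m = \<pi> m" if "m \<in> ?S" for \<pi> m
    unfolding extend_def using r_id[OF that] by simp
  have r_extend: "r (extend \<pi> m) = \<pi> (r m)" if "\<pi> permutes ?S" for \<pi> m
  proof -
    have "[extend \<pi> m = \<pi> (r m)] (mod int s)"
      unfolding extend_def using r_cong[of m] by (simp add: cong_iff_dvd_diff dvd_diff_commute)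
    then show ?thesis
      using r_eq r_id[of "\<pi> (r m)"] permutes_in_image[OF that, of "r m"] r_S by metis
  qed
  have extend_inv: "extend \<rho> (extend \<pi> m) = m"
    if "\<pi> permutes ?S" "\<And>x. \<rho> (\<pi> x) = x" for \<pi> \<rho> m
    using r_extend[OF that(1), of m] that(2) unfolding extend_def[of \<rho>] by (simp add: extend_def)
  have "bij_betw ?restrict ?Stab ?P"
  proof (rule bij_betw_byWitness[where f' = extend])
    show "\<forall>f\<in>?Stab. extend (?restrict f) = f"
    proof (intro ballI ext)
      fix f m assume "f \<in> ?Stab"
      then have "f \<in> carrier (G_group s t)" using Stab by blast
      then have "\<forall>m. f (m + int s) = f m + int s" unfolding mem_G_group by blast
      note per = periodic_shift[OF this]
      obtain k where k: "m = r m + int s * k" using r_diff by blast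
      have "extend (?restrict f) m = f (r m) + (m - r m)" unfolding extend_def using r_S by simp
      also have "\<dots> = f (r m) + int s * k" using k by linarith
      also have "\<dots> = f m" using per[of "r m" k] k by simp
      finally show "extend (?restrict f) m = f m" .
    qed
    show "\<forall>\<pi>\<in>?P. ?restrict (extend \<pi>) = \<pi>"
    proof (intro ballI ext)
      fix \<pi> m assume "\<pi> \<in> ?P"
      then show "?restrict (extend \<pi>) m = \<pi> m"
        using extend_S[of m \<pi>] permutes_not_in[of \<pi> ?S m] by simp
    qed
    show "?restrict ` ?Stab \<subseteq> ?P"
    proof
      fix \<pi> assume "\<pi> \<in> ?restrict ` ?Stab"
      then obtain f where f: "f \<in> carrier (G_group s t)" "f ` ?S = ?S" "\<pi> = ?restrict f"
        using Stab by blast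
      have fG: "bij f" "\<And>m. [f m = m] (mod int t)" using f(1) unfolding mem_G_group by auto
      have "inj_on f ?S" by (rule inj_on_subset[OF bij_is_inj[OF fG(1)]]) simp
      then have "bij_betw f ?S ?S" using f(2) unfolding bij_betw_def by simp
      then have "bij_betw \<pi> ?S ?S" by (rule bij_betw_cong[THEN iffD1, rotated]) (simp add: f(3))
      then have "\<pi> permutes ?S" by (rule bij_imp_permutes) (simp add: f(3))
      then show "\<pi> \<in> ?P" using fG(2) f(3) by (simp add: cong_def)
    qed
    show "extend ` ?P \<subseteq> ?Stab"
    proof
      fix f assume "f \<in> extend ` ?P"
      then obtain \<pi> where \<pi>: "\<pi> permutes ?S" "\<And>x. x \<in> ?S \<Longrightarrow> \<pi> x mod int t = x mod int t"
        "f = extend \<pi>" by blast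
      have "bij f"
        unfolding \<pi>(3)
      proof (rule o_bij)
        show "extend (inv_into UNIV \<pi>) \<circ> extend \<pi> = id"
          using extend_inv[OF \<pi>(1)] permutes_inverses(2)[OF \<pi>(1)] by (simp add: fun_eq_iff)
        show "extend \<pi> \<circ> extend (inv_into UNIV \<pi>) = id"
          using extend_inv[OF permutes_inv[OF \<pi>(1)]] permutes_inverses(1)[OF \<pi>(1)]
          by (simp add: fun_eq_iff)
      qed
      moreover have "f (m + int s) = f m + int s" for m
        using r_eq[of "m + int s" m] unfolding \<pi>(3) extend_def by (simp add: cong_iff_dvd_diff)
      moreover have "[f m = m] (mod int t)" for m
      proof -
        have "[\<pi> (r m) = r m] (mod int t)" using \<pi>(2)[OF r_S] by (simp add: cong_def)
        then show ?thesis unfolding \<pi>(3) extend_def by (simp add: cong_iff_dvd_diff)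
      qed
      moreover have "(\<Sum>i = 0..<int s. f i) = int (s choose 2)"
      proof -
        \<comment> \<open>A permutation of the \<open>s\<close>-set preserves its sum. Hence the
          sums of \<open>\<pi> (r i)\<close> and of \<open>r i\<close> cancel, leaving the sum of
          the residues.\<close>
        have sum_r: "(\<Sum>i = 0..<int s. g (r i)) = sum g ?S" for g :: "int \<Rightarrow> int"
          unfolding r_def using sum.reindex_bij_betw[OF s_set_residues, of g] .
        have "(\<Sum>i = 0..<int s. f i)
            = (\<Sum>i = 0..<int s. \<pi> (r i)) + ((\<Sum>i = 0..<int s. i) - (\<Sum>i = 0..<int s. r i))"
          unfolding \<pi>(3) extend_def by (simp add: sum.distrib sum_subtractf)
        moreover have "(\<Sum>i = 0..<int s. \<pi> (r i)) = (\<Sum>i = 0..<int s. r i)"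
          using sum_r[of \<pi>] sum_r[of "\<lambda>x. x"] sum.permute[OF \<pi>(1), of "\<lambda>x. x"] by (simp add: o_def)
        ultimately show ?thesis using sum_residues by simp
      qed
      moreover have "f ` ?S = \<pi> ` ?S"
        unfolding \<pi>(3) by (rule image_cong[OF refl]) (rule extend_S)
      then have "f ` ?S = ?S" using permutes_image[OF \<pi>(1)] by simp
      ultimately show "f \<in> ?Stab" unfolding Stab mem_G_group by blast
    qed
  qed
  then show ?thesis by (rule bij_betw_same_card)
qed

end

section \<open>The multiplicities and the order of the stabilizer\<close>

text \<open>Being a cardinality, the quotient is a natural number, so \<open>rat_fact\<close> yields
  its genuine factorial.\<close>

lemma core_w_eq_card:
  assumes "1 \<le> s" "1 \<le> t" "is_core s p"
  shows "core_w s t j (core_of t p)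
    = of_nat (card ((\<lambda>x. x - int s) ` s_set s p \<inter> {m. [m = j] (mod int t)}))"
  unfolding core_w_def core_difference_eq_card[OF assms] using assms(2) by simp

lemma core_z_eq_core_w: "core_z s t j q = core_w s t (int s * j + k_shift s t) q"
proof -
  have "int s * (j + 1) + k_shift s t = int s * j + k_shift s t + int s"
    by (simp add: algebra_simps)
  then show ?thesis unfolding core_z_def core_w_def by (simp only: divide_inverse mult.commute mult_1_left)
qed

theorem corollary4p4:
  fixes s t :: nat and p :: "nat \<Rightarrow> nat"
  assumes "s \<ge> 1" and "t \<ge> 1" and "coprime s t" and "is_core s p"
  shows "(\<forall>j::int. core_z s t j (core_of t p) =
            of_nat (card ((\<lambda>x. x - int s) ` s_set s p
                          \<inter> {m. [m = int s * j + k_shift s t] (mod int t)})))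
       \<and> (\<forall>j::int. core_w s t j (core_of t p) \<in> \<nat>)
       \<and> card (stabilizer (G_group s t) (G_action s) p) =
            (\<Prod>j = 0..<int t. rat_fact (core_w s t j (core_of t p)))
       \<and> (\<Prod>j = 0..<int t. rat_fact (core_w s t j (core_of t p))) =
            (\<Prod>j = 0..<int t. rat_fact (core_z s t j (core_of t p)))"
proof -
  let ?q = "core_of t p" and ?S = "s_set s p"
  note w = core_w_eq_card[OF assms(1,2,4)]
  define F where "F j = (fact (card {x \<in> ?S. x mod int t = j mod int t}) :: nat)" for j
  have F_cong: "F i = F j" if "[i = j] (mod int t)" for i j
    using that unfolding F_def cong_def by simp
  \<comment> \<open>The index moves by \<open>s\<close> because \<open>core_w\<close> counts
    elements of the \<open>s\<close>-set translated by \<open>- s\<close>, whereas \<open>F\<close>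
    counts untranslated ones.\<close>
  have w_F: "rat_fact (core_w s t j ?q) = F (j + int s)" for j
  proof -
    have "(\<lambda>x. x - int s) ` ?S \<inter> {m. [m = j] (mod int t)}
        = (\<lambda>x. x - int s) ` {x \<in> ?S. x mod int t = (j + int s) mod int t}"
      by (auto simp: cong_def mod_eq_dvd_iff algebra_simps)
    moreover have "card ((\<lambda>x. x - int s) ` A) = card A" for A
      by (rule card_image) (simp add: inj_on_def)
    ultimately show ?thesis unfolding w rat_fact_def F_def by simp
  qed
  have prod_w: "(\<Prod>j = 0..<int t. rat_fact (core_w s t j ?q)) = (\<Prod>j = 0..<int t. F j)"
    unfolding w_F
    by (rule prod_reindex_mod[OF assms(2) _ F_cong]) (simp_all add: cong_iff_dvd_diff)
  have prod_z: "(\<Prod>j = 0..<int t. rat_fact (core_z s t j ?q)) = (\<Prod>j = 0..<int t. F j)"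
    unfolding core_z_eq_core_w w_F
  proof (rule prod_reindex_mod[OF assms(2) _ F_cong])
    \<comment> \<open>Coprimality makes multiplication by \<open>s\<close> injective modulo
      \<open>t\<close>, so the indices of the \<open>z\<close> factors run through every class
      once.\<close>
    fix i j assume "[int s * i + k_shift s t + int s = int s * j + k_shift s t + int s] (mod int t)"
    then have "int t dvd int s * (i - j)" by (simp add: cong_iff_dvd_diff right_diff_distrib)
    moreover have "coprime (int t) (int s)" using assms(3) by (simp add: coprime_commute)
    ultimately show "[i = j] (mod int t)" by (simp add: coprime_dvd_mult_right_iff cong_iff_dvd_diff)
  qed
  have "card (stabilizer (G_group s t) (G_action s) p) = (\<Prod>j = 0..<int t. fact (card {x \<in> ?S. x mod int t = j}))"
    unfolding card_stabilizer[OF assms(1,4)]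
    by (rule card_fibre_permutations[OF finite_s_set[OF assms(1,4)]]) (use assms(2) in auto)
  also have "\<dots> = (\<Prod>j = 0..<int t. F j)"
    unfolding F_def by (rule prod.cong) auto
  finally have stab: "card (stabilizer (G_group s t) (G_action s) p) = (\<Prod>j = 0..<int t. F j)" .
  show ?thesis
    using stab prod_w prod_z w unfolding core_z_eq_core_w by auto
qed

end
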